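(* Let $x>1$ and let $n\ge 4$ be even. Put $$r(x,n)=\frac n2\left(x+\frac1x\right)-x,\qquad R(x,n)=\frac n2\left(x+\frac1x\right)-\frac1x,\qquad m(x,n)=\frac{n-1}{2}\left(x+\frac1x\right).$$ Then $m(x,n)$ is the arithmetic mean of $r(x,n)$ and $R(x,n)$, with $$R(x,n)-m(x,n)=m(x,n)-r(x,n)=\frac{x^2-1}{2x},$$ and the Perron root $\lambda_{\max}$ of $\mathbf{LPC}(x,n)$ satisfies $$1+r(x,n)\le \lambda_{\max}\le 1+R(x,n).$$ Moreover, $1+m(x,n)$ is not an eigenvalue of $\mathbf{LPC}(x,n)$; therefore $\lambda_{\max}<1+m(x,n)$, and all eigenvalues of $\mathbf{LPC}(x,n)$ are located inside the circle $|z-1|=m(x,n)$ in $\mathbb{C}$. Consequently, $$0<\frac{(x-1)^2}{2x}-\frac{x^2-1}{2x(n-1)}\le CI\bigl(\mathbf{LPC}(x,n)\bigr)<\frac{(x-1)^2}{2x}.$$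
   Context: The layer-cake matrix $\mathbf{LPC}(x,n)=(a_{ij})_{i,j=1}^n$ is defined by $a_{ii}=1$; for $i<j$, $a_{ij}=x$ if $j-i$ is odd and $a_{ij}=1/x$ if $j-i$ is even; and $a_{ji}=1/a_{ij}$ for $i<j$. The Perron root $\lambda_{\max}$ of a square matrix with positive entries is its spectral radius (which is an eigenvalue). For an $n\times n$ positive reciprocal matrix $\mathbf{A}=(a_{ij})$ (that is, $a_{ij}>0$ and $a_{ij}=1/a_{ji}$ for all $i,j$), the consistency index is $CI(\mathbf{A})=\dfrac{\lambda_{\max}(\mathbf{A})-n}{n-1}$.
   Formalization: The claim that the lower bound for CI is positive fails for some x>1 (n=4, x=3/2 gives -1/18); it is replaced by: this lower bound is positive if and only if x>n/(n-2). The inequality 0<CI and all other claims are proved for every x>1 and even n≥4. *)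

theory Defs
  imports "Jordan_Normal_Form.Spectral_Radius"
begin

text \<open>Matrix indices run over \<open>{0..<n}\<close>; the entries depend only on the index difference and on
  the side of the diagonal, so this agrees with the usual indexing by \<open>{1..n}\<close>.\<close>

definition lpc_upper :: "real \<Rightarrow> nat \<Rightarrow> nat \<Rightarrow> real" where
  "lpc_upper x i j = (if odd (j - i) then x else 1 / x)"

definition LPC :: "real \<Rightarrow> nat \<Rightarrow> real mat" where
  "LPC x n = mat n n (\<lambda>(i, j).
     if i = j then 1
     else if i < j then lpc_upper x i j
     else 1 / lpc_upper x j i)"

definition positive_reciprocal :: "real mat \<Rightarrow> bool" where
  "positive_reciprocal A \<longleftrightarrow> square_mat A \<and>
     (\<forall>i < dim_row A. \<forall>j < dim_row A. A $$ (i, j) > 0 \<and> A $$ (i, j) = 1 / A $$ (j, i))"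

abbreviation complex_mat :: "real mat \<Rightarrow> complex mat" where
  "complex_mat A \<equiv> map_mat complex_of_real A"

definition perron_root :: "real mat \<Rightarrow> real" where
  "perron_root A = spectral_radius (complex_mat A)"

text \<open>Meaningful for positive reciprocal matrices of dimension at least 2.\<close>

definition consistency_index :: "real mat \<Rightarrow> real" where
  "consistency_index A = (perron_root A - real (dim_row A)) / (real (dim_row A) - 1)"

lemma positive_reciprocal_LPC:
  assumes "x > 0"
  shows "positive_reciprocal (LPC x n)"
  using assms by (auto simp: positive_reciprocal_def LPC_def lpc_upper_def)

end

theory Submission
  imports Defs
begin

text \<open>The whole statement follows from one explicit positive eigenvector. Subtracting row \<open>i\<close> of the
  layer-cake matrix from row \<open>i + 2\<close> leaves only three nonzero entries, so an eigenvector for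
  \<open>1 + u\<close> satisfies a three-term recurrence with constant coefficients
  (\<open>lpc_row_step\<close>). Its characteristic roots are \<open>1\<close> and \<open>- q\<close> with
  \<open>q = (u + x) / (u + 1 / x)\<close>, which suggests \<open>w i = 1 + b * (- q) ^ i\<close>. The recurrence takes care of
  all rows but the first two (\<open>lpc_eigenvectorI\<close>). Those two rows involve geometric sums;
  eliminating \<open>b\<close> leaves a scalar equation for \<open>u\<close>. On
  the all-ones vector they take the values \<open>1 + R\<close> and \<open>1 + r\<close>, and the scalar equation changes sign strictly
  between \<open>u = r\<close> and the mean \<open>u = m\<close>. A root \<open>u\<close> with \<open>r < u < m\<close> therefore exists, and
  the corresponding \<open>w\<close> is positive (\<open>lpc_positive_eigenvector\<close>).

  A positive eigenvector of a positive matrix belongs to the spectral radius, hence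
  \<open>1 + u\<close> is the Perron root. Since the diagonal entries are all \<open>1\<close>, the same weighted maximum
  argument applied to the matrix minus the identity puts every eigenvalue into the disc
  of radius \<open>u < m\<close> around \<open>1\<close> (\<open>positive_eigenvector_disc\<close>); in particular \<open>1 + m\<close> is not an
  eigenvalue. The lower bound derived from \<open>r\<close> is positive only for \<open>x > n / (n - 2)\<close>, so
  positivity of the consistency index is obtained separately, from the arithmetic-geometric mean
  inequality applied to the pairs of reciprocal entries
  (\<open>inconsistent_reciprocal_eigenvalue_gt\<close>).\<close>

section \<open>Positive eigenvectors\<close>

text \<open>Subtracting \<open>d\<close> from the diagonal keeps the entries nonnegative and \<open>w\<close> an eigenvector. In the
  norm that measures the \<open>i\<close>-th coordinate in units of \<open>w i\<close>, a nonnegative matrix with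
  eigenvector \<open>w\<close> stretches vectors by at most the eigenvalue of \<open>w\<close>. With \<open>d = 0\<close> this is the
  usual bound for the spectral radius; a positive \<open>d\<close> gives the smaller disc centred at \<open>d\<close>.\<close>

lemma positive_eigenvector_disc:
  fixes A :: "real mat" and w :: "nat \<Rightarrow> real" and d l :: real
  assumes A: "A \<in> carrier_mat n n"
    and diag: "\<And>i. i < n \<Longrightarrow> d \<le> A $$ (i, i)"
    and off: "\<And>i j. i < n \<Longrightarrow> j < n \<Longrightarrow> i \<noteq> j \<Longrightarrow> 0 \<le> A $$ (i, j)"
    and w: "\<And>i. i < n \<Longrightarrow> 0 < w i"
    and eig: "\<And>i. i < n \<Longrightarrow> (\<Sum>j<n. A $$ (i, j) * w j) = l * w i"
    and z: "eigenvalue (complex_mat A) z"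
  shows "cmod (z - complex_of_real d) \<le> l - d"
proof -
  define B where "B i j = A $$ (i, j) - (if i = j then d else 0)" for i j
  have B0: "0 \<le> B i j" if "i < n" "j < n" for i j
    using diag off that by (auto simp: B_def)
  have shift: "(\<Sum>j<n. complex_of_real (B i j) * u j) =
      (\<Sum>j<n. complex_of_real (A $$ (i, j)) * u j) - complex_of_real d * u i"
    if "i < n" for i and u :: "nat \<Rightarrow> complex"
  proof -
    have "complex_of_real (B i j) * u j = complex_of_real (A $$ (i, j)) * u j -
        (if j = i then complex_of_real d * u j else 0)" for j
      by (simp add: B_def algebra_simps)
    then show ?thesis
      using that by (simp add: sum_subtractf)
  qed
  have Bw: "(\<Sum>j<n. B i j * w j) = (l - d) * w i" if "i < n" for i
  proof -
    have "B i j * w j = A $$ (i, j) * w j - (if j = i then d * w j else 0)" for j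
      by (simp add: B_def algebra_simps)
    then show ?thesis
      using that by (simp add: sum_subtractf eig left_diff_distrib)
  qed
  obtain v where v: "v \<in> carrier_vec n" "v \<noteq> 0\<^sub>v n" "complex_mat A *\<^sub>v v = z \<cdot>\<^sub>v v"
    using z A unfolding eigenvalue_def eigenvector_def by auto
  have Bv: "(\<Sum>j<n. complex_of_real (B i j) * v $ j) = (z - complex_of_real d) * v $ i"
    if i: "i < n" for i
  proof -
    have "(complex_mat A *\<^sub>v v) $ i = (z \<cdot>\<^sub>v v) $ i"
      using v(3) by simp
    then have "(\<Sum>j<n. complex_of_real (A $$ (i, j)) * v $ j) = z * v $ i"
      using i v(1) A by (simp add: scalar_prod_def lessThan_atLeast0)
    then show ?thesis
      using shift[OF i, of "\<lambda>j. v $ j"] by (simp add: algebra_simps)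
  qed
  obtain k where k: "k < n" "v $ k \<noteq> 0"
    using v(1,2) by (metis carrier_vecD dim_vec eq_vecI index_zero_vec(1) index_zero_vec(2))
  \<comment> \<open>The row inequality is read off at a coordinate where the weighted norm of the eigenvector is attained.\<close>
  define t where "t = Max ((\<lambda>i. cmod (v $ i) / w i) ` {..<n})"
  have fin: "finite ((\<lambda>i. cmod (v $ i) / w i) ` {..<n})"
    and ne: "(\<lambda>i. cmod (v $ i) / w i) ` {..<n} \<noteq> {}"
    using k by auto
  obtain i where i: "i < n" "t = cmod (v $ i) / w i"
    using Max_in[OF fin ne] unfolding t_def by auto
  have le_t: "cmod (v $ j) / w j \<le> t" if "j < n" for j
    unfolding t_def using fin that by (intro Max_ge) auto
  have le: "cmod (v $ j) \<le> t * w j" if "j < n" for j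
    using le_t[OF that] w[OF that] by (simp add: pos_divide_le_eq)
  have "0 < cmod (v $ k) / w k"
    using k w by simp
  with le_t[OF k(1)] have "0 < t"
    by linarith
  have "cmod (z - complex_of_real d) * (t * w i) = cmod (\<Sum>j<n. complex_of_real (B i j) * v $ j)"
    using Bv[OF i(1)] i w[OF i(1)] by (simp add: norm_mult)
  also have "\<dots> \<le> (\<Sum>j<n. B i j * cmod (v $ j))"
    by (rule order_trans[OF norm_sum]) (use B0[OF i(1)] in \<open>simp add: norm_mult\<close>)
  also have "\<dots> \<le> (\<Sum>j<n. B i j * (t * w j))"
    by (intro sum_mono mult_left_mono) (use B0 i le in auto)
  also have "\<dots> = t * (\<Sum>j<n. B i j * w j)"
    by (simp add: sum_distrib_left mult_ac)
  also have "\<dots> = (l - d) * (t * w i)"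
    using Bw[OF i(1)] by simp
  finally show ?thesis
    using \<open>0 < t\<close> w[OF i(1)] by simp
qed

lemma perron_root_eqI:
  fixes A :: "real mat" and w :: "nat \<Rightarrow> real" and l :: real
  assumes A: "A \<in> carrier_mat n n" and "0 < n"
    and nonneg: "\<And>i j. i < n \<Longrightarrow> j < n \<Longrightarrow> 0 \<le> A $$ (i, j)"
    and w: "\<And>i. i < n \<Longrightarrow> 0 < w i"
    and eig: "\<And>i. i < n \<Longrightarrow> (\<Sum>j<n. A $$ (i, j) * w j) = l * w i"
  shows "perron_root A = l"
proof -
  have cA: "complex_mat A \<in> carrier_mat n n"
    using A by simp
  define v where "v = vec n (\<lambda>i. complex_of_real (w i))"
  have "complex_mat A *\<^sub>v v = complex_of_real l \<cdot>\<^sub>v v"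
  proof (rule eq_vecI)
    fix i assume "i < dim_vec (complex_of_real l \<cdot>\<^sub>v v)"
    then have i: "i < n"
      by (simp add: v_def)
    have "(complex_mat A *\<^sub>v v) $ i = complex_of_real (\<Sum>j<n. A $$ (i, j) * w j)"
      using i A by (simp add: v_def scalar_prod_def lessThan_atLeast0)
    then show "(complex_mat A *\<^sub>v v) $ i = (complex_of_real l \<cdot>\<^sub>v v) $ i"
      using i eig[OF i] by (simp add: v_def)
  qed (use A in \<open>simp add: v_def\<close>)
  moreover have "v \<noteq> 0\<^sub>v n"
  proof
    assume "v = 0\<^sub>v n"
    then have "v $ 0 = 0"
      using \<open>0 < n\<close> by simp
    then show False
      using w[of 0] \<open>0 < n\<close> by (simp add: v_def)
  qed
  ultimately have ev: "eigenvalue (complex_mat A) (complex_of_real l)"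
    using A unfolding eigenvalue_def eigenvector_def by (intro exI[of _ v]) (auto simp: v_def)
  have bound: "cmod z \<le> l" if "eigenvalue (complex_mat A) z" for z
    using positive_eigenvector_disc[of A n 0 w l z] A nonneg w eig that by auto
  have "0 \<le> l"
    using bound[OF ev] by (smt (verit) norm_ge_zero)
  have "l \<le> spectral_radius (complex_mat A)"
    using spectral_radius_mem_max(2)[OF cA \<open>0 < n\<close>, of l] ev \<open>0 \<le> l\<close>
    unfolding spectrum_def by force
  moreover have "spectral_radius (complex_mat A) \<le> l"
    using spectral_radius_mem_max(1)[OF cA \<open>0 < n\<close>] bound unfolding spectrum_def by auto
  ultimately show ?thesis
    by (simp add: perron_root_def)
qed

text \<open>The scaled entries \<open>y i j = a i j * w j / w i\<close> again satisfy \<open>y i j * y j i = 1\<close>, so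
  \<open>y i j + y j i\<close> is at least \<open>2\<close>, while every row of \<open>y\<close> sums to \<open>l\<close>. Summing over
  all pairs gives \<open>l \<ge> n\<close>, with equality only if \<open>a i j = w i / w j\<close> throughout; a single triple that
  violates transitivity excludes that.\<close>

lemma inconsistent_reciprocal_eigenvalue_gt:
  fixes A :: "real mat" and w :: "nat \<Rightarrow> real" and l :: real
  assumes A: "A \<in> carrier_mat n n" and rec: "positive_reciprocal A"
    and w: "\<And>i. i < n \<Longrightarrow> 0 < w i"
    and eig: "\<And>i. i < n \<Longrightarrow> (\<Sum>j<n. A $$ (i, j) * w j) = l * w i"
    and triple: "i0 < n" "j0 < n" "k0 < n"
      "A $$ (i0, j0) * A $$ (j0, k0) \<noteq> A $$ (i0, k0)"
  shows "real n < l"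
proof (rule ccontr)
  assume "\<not> real n < l"
  have dim: "dim_row A = n"
    using A by simp
  define y where "y i j = A $$ (i, j) * w j / w i" for i j
  have y0: "0 < y i j" if "i < n" "j < n" for i j
  proof -
    have "0 < A $$ (i, j)"
      using rec that unfolding positive_reciprocal_def dim by blast
    then show ?thesis
      using w that by (simp add: y_def)
  qed
  have y1: "y i j * y j i = 1" if "i < n" "j < n" for i j
  proof -
    have "A $$ (i, j) = 1 / A $$ (j, i)" "0 < A $$ (j, i)"
      using rec that unfolding positive_reciprocal_def dim by blast+
    then have "A $$ (i, j) * A $$ (j, i) = 1"
      by simp
    then show ?thesis
      using w[OF that(1)] w[OF that(2)] by (simp add: y_def field_simps)
  qed
  have pair: "y i j + y j i - 2 = (1 - y i j)\<^sup>2 / y i j" if "i < n" "j < n" for i j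
  proof -
    have "y j i = 1 / y i j"
      using y1[OF that] y0[OF that] by (simp add: field_simps)
    then show ?thesis
      using y0[OF that] by (simp add: field_simps power2_eq_square)
  qed
  define g where "g = (\<lambda>(i, j). y i j + y j i - 2)"
  have g0: "0 \<le> g p" if "p \<in> {..<n} \<times> {..<n}" for p
    using that pair y0 by (force simp: g_def)
  have row: "(\<Sum>j<n. y i j) = l" if "i < n" for i
    using eig[OF that] w[OF that] by (simp add: y_def flip: sum_divide_distrib)
  have tot: "(\<Sum>i<n. \<Sum>j<n. y i j) = real n * l"
    using row by simp
  have tot': "(\<Sum>i<n. \<Sum>j<n. y j i) = real n * l"
    by (subst sum.swap) (rule tot)
  have "sum g ({..<n} \<times> {..<n}) = (\<Sum>i<n. \<Sum>j<n. y i j + y j i - 2)"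
    by (simp add: g_def sum.cartesian_product)
  also have "\<dots> = 2 * real n * (l - real n)"
    using tot tot' by (simp add: sum.distrib sum_subtractf algebra_simps)
  also have "\<dots> \<le> 0"
    using \<open>\<not> real n < l\<close> by (simp add: mult_nonneg_nonpos)
  finally have "sum g ({..<n} \<times> {..<n}) = 0"
    using sum_nonneg[of "{..<n} \<times> {..<n}" g] g0 by force
  then have gz: "\<forall>p \<in> {..<n} \<times> {..<n}. g p = 0"
    using sum_nonneg_eq_0_iff[of "{..<n} \<times> {..<n}" g] g0 by blast
  have Aw: "A $$ (i, j) = w i / w j" if "i < n" "j < n" for i j
  proof -
    have "(1 - y i j)\<^sup>2 / y i j = 0"
      using gz pair that by (force simp: g_def)
    then have "y i j = 1"
      using y0[OF that] by simp
    then show ?thesis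
      using w[OF that(1)] w[OF that(2)] by (simp add: y_def field_simps)
  qed
  show False
    using triple(4) Aw[OF triple(1,2)] Aw[OF triple(2,3)] Aw[OF triple(1,3)] w[OF triple(2)]
    by simp
qed

section \<open>Rows of the layer-cake matrix\<close>

definition lpc_entry :: "real \<Rightarrow> nat \<Rightarrow> nat \<Rightarrow> real" where
  "lpc_entry x i j =
     (if i = j then 1 else if i < j then lpc_upper x i j else 1 / lpc_upper x j i)"

lemma LPC_carrier: "LPC x n \<in> carrier_mat n n"
  by (simp add: LPC_def)

lemma LPC_index: "i < n \<Longrightarrow> j < n \<Longrightarrow> LPC x n $$ (i, j) = lpc_entry x i j"
  by (simp add: LPC_def lpc_entry_def)

text \<open>Rows \<open>i\<close> and \<open>i + 2\<close> agree outside columns \<open>i\<close>, \<open>i + 1\<close> and \<open>i + 2\<close>: elsewhere, both are on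
  the same side of the diagonal and the index differences have the same parity.\<close>

lemma lpc_row_step:
  assumes "i + 2 < n"
  shows "(\<Sum>j<n. lpc_entry x (i + 2) j * w j) = (\<Sum>j<n. lpc_entry x i j * w j) +
    (x - 1) * w i + (1 / x - x) * w (i + 1) + (1 - 1 / x) * w (i + 2)"
proof -
  define h where "h j = (lpc_entry x (i + 2) j - lpc_entry x i j) * w j" for j
  have "h j = 0" if "j \<notin> {i, i + 1, i + 2}" for j
  proof -
    have "j < i \<or> i + 2 < j"
      using that by simp linarith
    then have "lpc_entry x (i + 2) j = lpc_entry x i j"
      by (elim disjE) (simp_all add: lpc_entry_def lpc_upper_def)
    then show ?thesis
      by (simp add: h_def)
  qed
  then have "sum h {..<n} = sum h {i, i + 1, i + 2}"
    by (intro sum.mono_neutral_right) (use assms in auto)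
  also have "\<dots> = (x - 1) * w i + (1 / x - x) * w (i + 1) + (1 - 1 / x) * w (i + 2)"
    by (simp add: h_def lpc_entry_def lpc_upper_def)
  finally show ?thesis
    by (simp add: h_def left_diff_distrib sum_subtractf)
qed

lemma lpc_row_0_powers:
  fixes p x :: real
  shows "(\<Sum>j<2 * Suc k. lpc_entry x 0 j * p ^ j) =
    1 - 1 / x + (1 / x + x * p) * (\<Sum>j<Suc k. p ^ (2 * j))"
proof (induction k)
  case 0
  then show ?case
    by (simp add: lpc_entry_def lpc_upper_def numeral_2_eq_2 algebra_simps)
next
  case (Suc k)
  have "(\<Sum>j<2 * Suc (Suc k). lpc_entry x 0 j * p ^ j) =
      (\<Sum>j<2 * Suc k. lpc_entry x 0 j * p ^ j) +
      lpc_entry x 0 (2 * Suc k) * p ^ (2 * Suc k) +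
      lpc_entry x 0 (Suc (2 * Suc k)) * p ^ Suc (2 * Suc k)"
    by simp
  also have "\<dots> = (\<Sum>j<2 * Suc k. lpc_entry x 0 j * p ^ j) + (1 / x + x * p) * p ^ (2 * Suc k)"
    by (simp add: lpc_entry_def lpc_upper_def algebra_simps)
  finally show ?case
    unfolding Suc.IH by (simp add: algebra_simps)
qed

lemma lpc_row_1_powers:
  fixes p x :: real
  shows "(\<Sum>j<2 * Suc k. lpc_entry x 1 j * p ^ j) =
    1 / x - x + p * (1 - 1 / x) + (x + p / x) * (\<Sum>j<Suc k. p ^ (2 * j))"
proof (induction k)
  case 0
  then show ?case
    by (simp add: lpc_entry_def lpc_upper_def numeral_2_eq_2 algebra_simps)
next
  case (Suc k)
  have "(\<Sum>j<2 * Suc (Suc k). lpc_entry x 1 j * p ^ j) =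
      (\<Sum>j<2 * Suc k. lpc_entry x 1 j * p ^ j) +
      lpc_entry x 1 (2 * Suc k) * p ^ (2 * Suc k) +
      lpc_entry x 1 (Suc (2 * Suc k)) * p ^ Suc (2 * Suc k)"
    by simp
  also have "\<dots> = (\<Sum>j<2 * Suc k. lpc_entry x 1 j * p ^ j) + (x + p / x) * p ^ (2 * Suc k)"
    by (simp add: lpc_entry_def lpc_upper_def algebra_simps)
  finally show ?case
    unfolding Suc.IH by (simp add: algebra_simps)
qed

text \<open>The hypothesis \<open>quad\<close> is the characteristic equation of the recurrence given by \<open>lpc_row_step\<close>;
  the constant sequence solves that recurrence for every \<open>l\<close>. Two consecutive rows start the
  induction.\<close>

lemma lpc_eigenvectorI:
  fixes p x b l :: real
  assumes quad: "l * (p\<^sup>2 - 1) = (x - 1) + (1 / x - x) * p + (1 - 1 / x) * p\<^sup>2"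
    and row0: "(\<Sum>j<n. lpc_entry x 0 j * (1 + b * p ^ j)) = l * (1 + b)"
    and row1: "(\<Sum>j<n. lpc_entry x 1 j * (1 + b * p ^ j)) = l * (1 + b * p)"
    and "i < n"
  shows "(\<Sum>j<n. lpc_entry x i j * (1 + b * p ^ j)) = l * (1 + b * p ^ i)"
  using \<open>i < n\<close>
proof (induction i rule: less_induct)
  case (less i)
  consider "i = 0" | "i = 1" | k where "i = k + 2"
    by (metis One_nat_def add_2_eq_Suc' not0_implies_Suc)
  then show ?case
  proof cases
    case (3 k)
    have IH: "(\<Sum>j<n. lpc_entry x k j * (1 + b * p ^ j)) = l * (1 + b * p ^ k)"
      using less 3 by simp
    have "k + 2 < n"
      using less.prems 3 by simp
    have "(\<Sum>j<n. lpc_entry x i j * (1 + b * p ^ j)) = l * (1 + b * p ^ k) +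
        (x - 1) * (1 + b * p ^ k) + (1 / x - x) * (1 + b * p ^ (k + 1)) +
        (1 - 1 / x) * (1 + b * p ^ (k + 2))"
      unfolding 3 lpc_row_step[OF \<open>k + 2 < n\<close>] IH ..
    also have "\<dots> = l * (1 + b * p ^ k) +
        b * p ^ k * ((x - 1) + (1 / x - x) * p + (1 - 1 / x) * p\<^sup>2)"
      by (simp add: algebra_simps power2_eq_square)
    also have "\<dots> = l * (1 + b * p ^ i)"
      unfolding quad[symmetric] 3 by (simp add: algebra_simps power2_eq_square)
    finally show ?thesis .
  qed (use row0 row1 in simp_all)
qed

section \<open>The Perron vector\<close>

text \<open>Rows \<open>0\<close> and \<open>1\<close> reduce to \<open>R - u = b * D * P0 / W\<close> and \<open>u - r = b * D * P1 / W\<close>, with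
  \<open>D = u + 1 / x\<close>, \<open>W = 2 * u + x + 1 / x\<close> and \<open>P0\<close>, \<open>P1\<close> as in the proof. The first determines \<open>b\<close>;
  the two are compatible iff \<open>(R - u) * P1 = (u - r) * P0\<close>. As \<open>0 < P1 < P0\<close>, the two
  sides can only balance where \<open>R - u\<close> exceeds \<open>u - r\<close>, that is, strictly below the
  mean of \<open>r\<close> and \<open>R\<close>.\<close>

lemma lpc_positive_eigenvector:
  fixes x :: real and k :: nat
  assumes x: "1 < x" and k: "2 \<le> k"
  obtains u w where
    "real k * (x + 1 / x) - x < u" "u < (2 * real k - 1) / 2 * (x + 1 / x)"
    "\<And>i. i < 2 * k \<Longrightarrow> 0 < w i"
    "\<And>i. i < 2 * k \<Longrightarrow> (\<Sum>j<2 * k. lpc_entry x i j * w j) = (1 + u) * w i"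
proof -
  define s where "s = x + 1 / x"
  define d where "d = x - 1 / x"
  define R where "R = real k * s - 1 / x"
  define r where "r = real k * s - x"
  define m where "m = (2 * real k - 1) / 2 * s"
  have inv: "0 < 1 / x" "1 / x < 1"
    using x by auto
  have d: "0 < d" and sd: "d < s" and s0: "0 < s"
    using x inv unfolding d_def s_def by linarith+
  have ks: "2 * s \<le> real k * s"
    using k s0 by (intro mult_right_mono) auto
  have r0: "0 < r"
    using ks inv x unfolding r_def s_def by argo
  have Rr: "R - r = d"
    by (simp add: R_def r_def d_def)
  have mean: "R - m = m - r" and Rm: "R - m = d / 2"
    by (simp_all add: R_def m_def r_def s_def d_def field_simps)
  define q where "q u = (u + x) / (u + 1 / x)" for u
  define E where "E u = q u ^ (2 * k) - 1" for u
  define P0 where "P0 u = (2 * u + s) + (u + s) * E u" for u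
  define P1 where "P1 u = (2 * u + s) + u * E u" for u
  have q1: "1 < q u" if "r \<le> u" for u
  proof -
    have "0 < u + 1 / x" "u + 1 / x < u + x"
      using that r0 inv x by linarith+
    then show ?thesis
      unfolding q_def by (metis less_divide_eq_1_pos)
  qed
  have E0: "0 < E u" if "r \<le> u" for u
    using one_less_power[OF q1[OF that], of "2 * k"] k by (simp add: E_def)
  have P0_pos: "0 < P0 u" if "r \<le> u" for u
    using that r0 s0 E0[OF that] unfolding P0_def by (intro add_pos_pos mult_pos_pos) auto
  define F where "F u = (R - u) * P1 u - (u - r) * P0 u" for u
  have F_r: "0 < F r"
  proof -
    have "0 < P1 r"
      using r0 s0 E0[of r] unfolding P1_def by (intro add_pos_pos mult_pos_pos) auto
    then show ?thesis
      using d Rr by (simp add: F_def)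
  qed
  have F_m: "F m < 0"
  proof -
    have "F m = - (R - m) * s * E m"
      unfolding F_def P0_def P1_def mean[symmetric] by (simp add: algebra_simps)
    moreover have "r \<le> m"
      using mean Rm d by simp
    ultimately show ?thesis
      using Rm d s0 E0[of m] by simp
  qed
  have "r < m"
    using mean Rm d by simp
  have contF: "continuous_on {r..m} F"
    unfolding F_def P0_def P1_def E_def q_def
    by (intro continuous_intros) (use r0 inv in \<open>smt (verit) atLeastAtMost_iff\<close>)+
  obtain u where u: "r \<le> u" "u \<le> m" "F u = 0"
    using IVT2'[of F m 0 r] F_r F_m \<open>r < m\<close> contF by fastforce
  then have u': "r < u" "u < m"
    using F_r F_m by (auto simp: less_le)
  define D where "D = u + 1 / x"
  define W where "W = 2 * u + s"
  define T where "T = (\<Sum>j<k. (- q u) ^ (2 * j))"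
  define b where "b = (R - u) * W / (D * P0 u)"
  have D0: "0 < D" and W0: "0 < W"
    using u r0 inv s0 unfolding D_def W_def by linarith+
  have Dd: "d \<le> D"
    using u ks inv unfolding D_def d_def r_def s_def by argo
  have Ru: "0 < R - u" "R - u < d"
    using u' Rr Rm d by auto
  have b0: "0 < b"
    using Ru W0 D0 P0_pos[OF u(1)] by (simp add: b_def)
  have qD: "q u * D = D + d"
    using D0 by (simp add: q_def D_def d_def)
  have WD: "W = 2 * D + d"
    by (simp add: W_def D_def d_def s_def)
  \<comment> \<open>The geometric sum in closed form, cleared of denominators: \<open>(q\<^sup>2 - 1) * D\<^sup>2 = (q * D - D) * (q * D + D) = d * W\<close>.\<close>
  have T: "T * (d * W) = E u * D\<^sup>2"
  proof -
    have "T = (\<Sum>j<k. ((q u)\<^sup>2) ^ j)"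
      by (simp add: T_def power_mult)
    then have "T * ((q u)\<^sup>2 - 1) = ((q u)\<^sup>2) ^ k - 1"
      by (simp only: power_diff_1_eq[of "(q u)\<^sup>2" k] mult.commute)
    then have "T * ((q u)\<^sup>2 - 1) = E u"
      by (simp add: E_def power_mult)
    moreover have "((q u)\<^sup>2 - 1) * D\<^sup>2 = d * W"
    proof -
      have "((q u)\<^sup>2 - 1) * D\<^sup>2 = (q u * D)\<^sup>2 - D\<^sup>2"
        by (simp add: algebra_simps power_mult_distrib)
      then show ?thesis
        unfolding qD WD by (simp add: algebra_simps power2_eq_square)
    qed
    ultimately show ?thesis
      by (metis mult.assoc)
  qed
  have c0: "(x * q u - 1 / x) * D = d * (u + s)"
    using x D0 unfolding left_diff_distrib mult.assoc qD
    by (simp add: D_def d_def s_def field_simps)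
  have c1: "(x - q u / x) * D = d * u"
    using x D0 qD by (simp add: left_diff_distrib D_def d_def) (simp add: field_simps)
  have t0: "(x * q u - 1 / x) * T * W = D * ((u + s) * E u)"
  proof -
    have "d * D * ((x * q u - 1 / x) * T * W) = ((x * q u - 1 / x) * D) * (T * (d * W))"
      by simp
    also have "\<dots> = d * D * (D * ((u + s) * E u))"
      unfolding c0 T by (simp add: power2_eq_square)
    finally show ?thesis
      using d D0 by simp
  qed
  have t1: "(x - q u / x) * T * W = D * (u * E u)"
  proof -
    have "d * D * ((x - q u / x) * T * W) = ((x - q u / x) * D) * (T * (d * W))"
      by simp
    also have "\<dots> = d * D * (D * (u * E u))"
      unfolding c1 T by (simp add: power2_eq_square)
    finally show ?thesis
      using d D0 by simp
  qed
  have e0: "b * (D + (x * q u - 1 / x) * T) = R - u"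
  proof -
    have "(D + (x * q u - 1 / x) * T) * W = D * P0 u"
      using t0 by (simp add: P0_def W_def distrib_left distrib_right mult.commute)
    then have "D + (x * q u - 1 / x) * T = D * P0 u / W"
      using W0 by (simp add: field_simps)
    then show ?thesis
      using W0 D0 P0_pos[OF u(1)] by (simp add: b_def)
  qed
  have e1: "b * (D + (x - q u / x) * T) = u - r"
  proof -
    have "(D + (x - q u / x) * T) * W = D * P1 u"
      using t1 by (simp add: P1_def W_def distrib_left distrib_right mult.commute)
    then have "D + (x - q u / x) * T = D * P1 u / W"
      using W0 by (simp add: field_simps)
    then have "b * (D + (x - q u / x) * T) = (R - u) * P1 u / P0 u"
      using W0 D0 by (simp add: b_def)
    also have "\<dots> = u - r"
      using u(3) P0_pos[OF u(1)] by (simp add: F_def field_simps)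
    finally show ?thesis .
  qed
  define w where "w j = 1 + b * (- q u) ^ j" for j
  have split: "(\<Sum>j<2 * k. lpc_entry x i j * w j) = (\<Sum>j<2 * k. lpc_entry x i j * 1 ^ j) +
      b * (\<Sum>j<2 * k. lpc_entry x i j * (- q u) ^ j)" for i
    by (simp add: w_def distrib_left sum.distrib sum_distrib_left mult_ac)
  obtain k' where k': "k = Suc k'"
    using k by (cases k) auto
  have row0: "(\<Sum>j<2 * k. lpc_entry x 0 j * w j) = (1 + u) * (1 + b)"
  proof -
    have "(\<Sum>j<2 * k. lpc_entry x 0 j * w j) =
        1 - 1 / x + (1 / x + x) * real k + b * (1 - 1 / x + (1 / x - x * q u) * T)"
      unfolding split unfolding k' lpc_row_0_powers T_def by simp
    also have "\<dots> = 1 + R + b * (1 + u) - b * (D + (x * q u - 1 / x) * T)"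
      by (simp add: R_def s_def D_def algebra_simps)
    finally show ?thesis
      unfolding e0 by (simp add: algebra_simps)
  qed
  have row1: "(\<Sum>j<2 * k. lpc_entry x 1 j * w j) = (1 + u) * (1 + b * (- q u))"
  proof -
    have "(\<Sum>j<2 * k. lpc_entry x 1 j * w j) = 1 / x - x + (1 - 1 / x) + (x + 1 / x) * real k +
        b * (1 / x - x + (- q u) * (1 - 1 / x) + (x - q u / x) * T)"
      unfolding split unfolding k' lpc_row_1_powers T_def by simp
    also have "\<dots> = 1 + r + b * (q u * D - d - (1 + u) * q u + (x - q u / x) * T)"
      by (simp add: r_def s_def D_def d_def algebra_simps)
    also have "\<dots> = 1 + r - b * ((1 + u) * q u) + b * (D + (x - q u / x) * T)"
      unfolding qD by (simp add: algebra_simps)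
    finally show ?thesis
      unfolding e1 by (simp add: algebra_simps)
  qed
  have quad: "(1 + u) * ((- q u)\<^sup>2 - 1) =
      (x - 1) + (1 / x - x) * (- q u) + (1 - 1 / x) * (- q u)\<^sup>2"
  proof -
    have "q u * (q u * D) + (1 / x - x) * q u = q u * D"
      using arg_cong[OF qD, of "\<lambda>t. q u * t"] by (simp add: d_def algebra_simps)
    also have "\<dots> = u + x"
      unfolding qD by (simp add: D_def d_def)
    finally show ?thesis
      by (simp add: D_def power2_eq_square algebra_simps)
  qed
  have eig: "(\<Sum>j<2 * k. lpc_entry x i j * w j) = (1 + u) * w i" if "i < 2 * k" for i
    using lpc_eigenvectorI[OF quad, where n = "2 * k" and b = b and i = i] row0 row1 that by (simp add: w_def)
  \<comment> \<open>Positivity of \<open>w\<close> amounts to \<open>b * q ^ (2 * k - 1) < 1\<close>. The bounds \<open>R - u < d \<le> D\<close> and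
      \<open>W / 2 * q ^ (2 * k) \<le> P0\<close> suffice because \<open>q * D = D + d \<ge> 2 * d\<close>; the inequality \<open>d \<le> D\<close> is where
      \<open>k \<ge> 2\<close> enters.\<close>
  have small: "b * q u ^ (2 * k - 1) < 1"
  proof -
    define Q where "Q = q u ^ (2 * k - 1)"
    have Q0: "0 < Q"
      using q1[OF u(1)] by (simp add: Q_def)
    have QD: "q u ^ (2 * k) * D = Q * (D + d)"
    proof -
      have "q u ^ (2 * k) = Q * q u"
        using k unfolding Q_def by (simp flip: power_Suc2)
      then show ?thesis
        using qD by simp
    qed
    have "(R - u) * W * Q < d * W * Q"
      using Ru W0 Q0 by simp
    also have "\<dots> \<le> W / 2 * (Q * (D + d))"
      using Dd W0 Q0 by (simp add: field_simps)
    also have "\<dots> = W / 2 * (E u + 1) * D"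
      unfolding QD[symmetric] by (simp add: E_def)
    also have "\<dots> \<le> P0 u * D"
    proof (rule mult_right_mono)
      have "W / 2 * E u \<le> (u + s) * E u"
        using E0[OF u(1)] s0 by (intro mult_right_mono) (auto simp: W_def)
      moreover have "W / 2 \<le> W"
        using W0 by simp
      ultimately show "W / 2 * (E u + 1) \<le> P0 u"
        unfolding P0_def W_def[symmetric] distrib_left by linarith
    qed (use D0 in simp)
    finally show ?thesis
      using D0 P0_pos[OF u(1)] by (simp add: b_def Q_def mult.commute)
  qed
  have pos: "0 < w i" if "i < 2 * k" for i
  proof -
    have "\<bar>b * (- q u) ^ i\<bar> = b * q u ^ i"
      using b0 q1[OF u(1)] by (simp add: abs_mult power_abs)
    also have "\<dots> \<le> b * q u ^ (2 * k - 1)"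
      using that b0 q1[OF u(1)] by (intro mult_left_mono power_increasing) auto
    finally show ?thesis
      using small by (simp add: w_def)
  qed
  show ?thesis
    using that[of u w] u' pos eig by (simp add: r_def m_def s_def)
qed

section \<open>The Perron root\<close>

theorem mainTheorem3:
  fixes x r R m :: real and n :: nat
  assumes "x > 1" and "n \<ge> 4" and "even n"
    and "r = real n / 2 * (x + 1 / x) - x"
    and "R = real n / 2 * (x + 1 / x) - 1 / x"
    and "m = (real n - 1) / 2 * (x + 1 / x)"
  shows "m = (r + R) / 2 \<and>
    R - m = (x\<^sup>2 - 1) / (2 * x) \<and>
    m - r = (x\<^sup>2 - 1) / (2 * x) \<and>
    1 + r \<le> perron_root (LPC x n) \<and>
    perron_root (LPC x n) \<le> 1 + R \<and>
    \<not> eigenvalue (complex_mat (LPC x n)) (complex_of_real (1 + m)) \<and>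
    perron_root (LPC x n) < 1 + m \<and>
    (\<forall>z. eigenvalue (complex_mat (LPC x n)) z \<longrightarrow> cmod (z - 1) < m) \<and>
    (0 < (x - 1)\<^sup>2 / (2 * x) - (x\<^sup>2 - 1) / (2 * x * (real n - 1)) \<longleftrightarrow> x > real n / (real n - 2)) \<and>
    0 < consistency_index (LPC x n) \<and>
    (x - 1)\<^sup>2 / (2 * x) - (x\<^sup>2 - 1) / (2 * x * (real n - 1)) \<le> consistency_index (LPC x n) \<and>
    consistency_index (LPC x n) < (x - 1)\<^sup>2 / (2 * x)"
proof -
  obtain k where k: "n = 2 * k"
    using \<open>even n\<close> by blast
  then have k2: "2 \<le> k"
    using \<open>4 \<le> n\<close> by simp
  have x: "0 < x" "x \<noteq> 0"
    using \<open>1 < x\<close> by auto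
  obtain u w where
    u: "real k * (x + 1 / x) - x < u" "u < (2 * real k - 1) / 2 * (x + 1 / x)"
    and w: "\<And>i. i < 2 * k \<Longrightarrow> 0 < w i"
    and eig: "\<And>i. i < 2 * k \<Longrightarrow> (\<Sum>j<2 * k. lpc_entry x i j * w j) = (1 + u) * w i"
    using lpc_positive_eigenvector[OF \<open>1 < x\<close> k2] by blast
  have w': "0 < w i" if "i < n" for i
    using w that k by simp
  have eig': "(\<Sum>j<n. LPC x n $$ (i, j) * w j) = (1 + u) * w i" if "i < n" for i
    using eig that k by (simp add: LPC_index)
  have rec: "positive_reciprocal (LPC x n)"
    using positive_reciprocal_LPC x by blast
  have entry_pos: "0 < LPC x n $$ (i, j)" if "i < n" "j < n" for i j
    using x that by (simp add: LPC_index lpc_entry_def lpc_upper_def)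
  have root: "perron_root (LPC x n) = 1 + u"
    using perron_root_eqI[OF LPC_carrier, of n x w "1 + u"] \<open>4 \<le> n\<close> entry_pos w' eig'
    by (simp add: less_imp_le)
  have disc: "cmod (z - 1) \<le> u" if "eigenvalue (complex_mat (LPC x n)) z" for z
  proof -
    have "1 \<le> LPC x n $$ (i, i)" if "i < n" for i
      using that by (simp add: LPC_index lpc_entry_def)
    from positive_eigenvector_disc[OF LPC_carrier this less_imp_le[OF entry_pos] w' eig' that]
    show ?thesis
      by simp
  qed
  have ru: "r < u" and um: "u < m"
    using u k assms(4,6) by simp_all
  have mean: "m = (r + R) / 2" and Rm: "R - m = (x\<^sup>2 - 1) / (2 * x)"
    and mr: "m - r = (x\<^sup>2 - 1) / (2 * x)"
    using x unfolding assms(4,5,6) by (auto simp: field_simps power2_eq_square)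
  have gap: "0 < (x\<^sup>2 - 1) / (2 * x)"
    using \<open>1 < x\<close> by (simp add: one_less_power)
  have disc': "cmod (z - 1) < m" if "eigenvalue (complex_mat (LPC x n)) z" for z
    using disc[OF that] um by simp
  have "0 < m"
    unfolding assms(6) using \<open>4 \<le> n\<close> x by (intro mult_pos_pos add_pos_pos) auto
  then have not_eig: "\<not> eigenvalue (complex_mat (LPC x n)) (complex_of_real (1 + m))"
    using disc'[of "complex_of_real (1 + m)"] by auto
  \<comment> \<open>The first three indices are intransitive, since \<open>x * x \<noteq> 1 / x\<close>.\<close>
  have "LPC x n $$ (0, 1) * LPC x n $$ (1, 2) \<noteq> LPC x n $$ (0, 2)"
  proof -
    have "1 < x * x * x"
      using \<open>1 < x\<close> by (simp add: less_1_mult)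
    then have "x * x \<noteq> 1 / x"
      using x by (simp add: field_simps)
    then show ?thesis
      using \<open>4 \<le> n\<close> by (simp add: LPC_index lpc_entry_def lpc_upper_def)
  qed
  then have large: "real n < 1 + u"
    using inconsistent_reciprocal_eigenvalue_gt[OF LPC_carrier rec w' eig', of 0 1 2] \<open>4 \<le> n\<close>
    by auto
  have n1: "0 < real n - 1" and n2: "0 < real n - 2"
    using \<open>4 \<le> n\<close> by auto
  have CI: "consistency_index (LPC x n) = (1 + u - real n) / (real n - 1)"
    using LPC_carrier[of x n] by (simp add: consistency_index_def root)
  have mid: "(x - 1)\<^sup>2 / (2 * x) = (1 + m - real n) / (real n - 1)"
    using x n1 unfolding assms(6) by (simp add: field_simps power2_eq_square)
  have low: "(x - 1)\<^sup>2 / (2 * x) - (x\<^sup>2 - 1) / (2 * x * (real n - 1)) =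
      (1 + r - real n) / (real n - 1)"
  proof -
    have "(x\<^sup>2 - 1) / (2 * x * (real n - 1)) = (m - r) / (real n - 1)"
      unfolding mr by simp
    then show ?thesis
      unfolding mid by (simp add: diff_divide_distrib[symmetric])
  qed
  have threshold: "0 < (x - 1)\<^sup>2 / (2 * x) - (x\<^sup>2 - 1) / (2 * x * (real n - 1)) \<longleftrightarrow>
      x > real n / (real n - 2)"
  proof -
    define c where "c = (x - 1) / (2 * x * (real n - 1))"
    have "(x - 1)\<^sup>2 / (2 * x) - (x\<^sup>2 - 1) / (2 * x * (real n - 1)) =
        c * (x * (real n - 2) - real n)"
      using x n1 unfolding c_def by (simp add: field_simps power2_eq_square)
    moreover have "0 < c"
      using \<open>1 < x\<close> x n1 by (simp add: c_def)
    ultimately show ?thesis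
      using n2 by (simp add: zero_less_mult_iff pos_divide_less_eq)
  qed
  show ?thesis
    unfolding root CI
  proof (intro conjI allI impI)
    show "(x - 1)\<^sup>2 / (2 * x) - (x\<^sup>2 - 1) / (2 * x * (real n - 1)) \<le> (1 + u - real n) / (real n - 1)"
      unfolding low using n1 ru by (intro divide_right_mono) auto
    show "(1 + u - real n) / (real n - 1) < (x - 1)\<^sup>2 / (2 * x)"
      unfolding mid using n1 um by (intro divide_strict_right_mono) auto
    show "1 + u \<le> 1 + R"
      using um Rm gap by simp
  qed (use mean Rm mr ru um not_eig disc' threshold large n1 in auto)
qed

end
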